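(* Let $1\le t\le\min(m,n)$ and let $\pi\colon T(M^t_{m,n})\to M^t_{m,n}$ be one of the following three transformations of $(M^t_{m,n},M^{t-1}_{m,n})$: the Tjurina transform $\operatorname{Tjur}(M^t_{m,n})$, the transpose Tjurina transform $\operatorname{Tjur}^T(M^t_{m,n})$, or the Nash transform $\operatorname{Nash}(M^t_{m,n})$. Then $T(M^t_{m,n})$ is homotopy equivalent to $\pi^{-1}(0)$, where $0$ is the zero matrix.
   Context: $M_{m,n}$ is the set of $m\times n$ complex matrices, and $M^t_{m,n}\subset M_{m,n}$ (the model determinantal singularity of type $(m,n,t)$) is the subset of matrices of rank $<t$, with $M^0_{m,n}=\emptyset$; its dimension is $d=mn-(m-t+1)(n-t+1)$. $\operatorname{Gr}(k,r)$ (respectively $\operatorname{Gr}(k,V)$) is the Grassmannian of $k$-dimensional linear subspaces of $\mathbb{C}^r$ (respectively of the vector space $V$). Regarding $A\in M_{m,n}$ as a linear map $A\colon\mathbb{C}^n\to\mathbb{C}^m$, define $$\operatorname{Tjur}(M^t_{m,n})=\{(A,W)\in M_{m,n}\times \operatorname{Gr}(n-t+1,n) \mid A(W)=0\},$$ $$\operatorname{Tjur}^T(M^t_{m,n})=\{(A,W)\in M_{m,n}\times \operatorname{Gr}(m-t+1,m) \mid A^T(W)=0\}.$$ The Nash transform $\operatorname{Nash}(M^t_{m,n})$ is the closure in $M_{m,n}\times \operatorname{Gr}(d,M_{m,n})$ of the graph of the Gauss map $A\mapsto T_A M^t_{m,n}$ defined on the points $A\in M^t_{m,n}\setminus M^{t-1}_{m,n}$.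 In all three cases $\pi$ is the projection to the first factor. *)

theory Defs
  imports "HOL-Analysis.Analysis"
begin

section \<open>Matrices as a complex vector space\<close>

text \<open>
  The type \<^typ>\<open>complex^'n^'m\<close> carries only a real scalar multiplication in the library (the
  operation \<open>*s\<close> scales by a row vector, componentwise in the rows).
\<close>

definition mscale :: "complex \<Rightarrow> complex^'n^'m \<Rightarrow> complex^'n^'m" where
  "mscale c A = (\<chi> i j. c * A $ i $ j)"

interpretation cmat: vector_space "mscale :: complex \<Rightarrow> complex^'n^'m \<Rightarrow> complex^'n^'m"
  by unfold_locales (auto simp only: mscale_def vec_eq_iff vec_lambda_beta vector_add_component
    distrib_left distrib_right mult.assoc mult_1_left)


section \<open>Grassmannians\<close>

text \<open>
  The scalar multiplication is a parameter, so that the same definition serves for column vectors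
  (with \<open>*s\<close>) and for matrices (with \<^const>\<open>mscale\<close>).
\<close>

definition grassmannian ::
  "(complex \<Rightarrow> 'v \<Rightarrow> 'v::ab_group_add) \<Rightarrow> nat \<Rightarrow> 'v set set" where
  "grassmannian smul k = {W. module.subspace smul W \<and> vector_space.dim smul W = k}"

text \<open>
  Linearly independent \<open>k\<close>-tuples, topologised as a subspace of the \<open>k\<close>-fold power of the vector
  space; the restriction to extensional functions comes from \<^const>\<open>product_topology\<close>.
\<close>

definition frame_topology ::
  "(complex \<Rightarrow> 'v \<Rightarrow> 'v::{ab_group_add,topological_space}) \<Rightarrow> nat \<Rightarrow> (nat \<Rightarrow> 'v) topology" where
  "frame_topology smul k =
     subtopology (product_topology (\<lambda>_. euclidean) {..<k})
       {f. inj_on f {..<k} \<and> \<not> module.dependent smul (f ` {..<k})}"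

text \<open>The quotient topology induced by sending a frame to its span.\<close>

definition grassmannian_topology ::
  "(complex \<Rightarrow> 'v \<Rightarrow> 'v::{ab_group_add,topological_space}) \<Rightarrow> nat \<Rightarrow> 'v set topology" where
  "grassmannian_topology smul k =
     topology (\<lambda>U. U \<subseteq> grassmannian smul k \<and>
       openin (frame_topology smul k)
         {f \<in> topspace (frame_topology smul k). module.span smul (f ` {..<k}) \<in> U})"

lemma openin_grassmannian_topology:
  "openin (grassmannian_topology smul k) U \<longleftrightarrow>
     U \<subseteq> grassmannian smul k \<and>
     openin (frame_topology smul k)
       {f \<in> topspace (frame_topology smul k). module.span smul (f ` {..<k}) \<in> U}"
proof -
  let ?X = "frame_topology smul k"
  let ?P = "\<lambda>U. {f \<in> topspace ?X. module.span smul (f ` {..<k}) \<in> U}"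
  have Int: "?P (S \<inter> T) = ?P S \<inter> ?P T" for S T by auto
  have Un: "?P (\<Union>K) = \<Union> (?P ` K)" for K by auto
  have "istopology (\<lambda>U. U \<subseteq> grassmannian smul k \<and> openin ?X (?P U))"
    unfolding istopology_def
  proof (intro conjI allI impI)
    fix K
    assume K: "\<forall>U\<in>K. U \<subseteq> grassmannian smul k \<and> openin ?X (?P U)"
    show "\<Union>K \<subseteq> grassmannian smul k" using K by blast
    show "openin ?X (?P (\<Union>K))" unfolding Un using K by (intro openin_Union) blast
  next
    fix S T
    assume ST: "S \<subseteq> grassmannian smul k \<and> openin ?X (?P S)"
      "T \<subseteq> grassmannian smul k \<and> openin ?X (?P T)"
    show "S \<inter> T \<subseteq> grassmannian smul k" using ST by blast
    show "openin ?X (?P (S \<inter> T))" unfolding Int using ST by (intro openin_Int) blast+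
  qed
  then show ?thesis
    unfolding grassmannian_topology_def by (rule topology_inverse'[THEN fun_cong])
qed

lemma topspace_grassmannian_topology:
  assumes "vector_space smul"
  shows "topspace (grassmannian_topology smul k) = grassmannian smul k"
proof -
  interpret vector_space smul by fact
  have span: "module.span smul (f ` {..<k}) \<in> grassmannian smul k"
    if "f \<in> topspace (frame_topology smul k)" for f
  proof -
    from that have inj: "inj_on f {..<k}" and indep: "\<not> module.dependent smul (f ` {..<k})"
      unfolding frame_topology_def topspace_subtopology by blast+
    have "dim (span (f ` {..<k})) = k"
      using dim_span_eq_card_independent[OF indep] card_image[OF inj] by simp
    then show ?thesis
      unfolding grassmannian_def using subspace_span by blast
  qed
  have "{f \<in> topspace (frame_topology smul k).
      module.span smul (f ` {..<k}) \<in> grassmannian smul k} = topspace (frame_topology smul k)"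
    using span by blast
  then have gr: "openin (grassmannian_topology smul k) (grassmannian smul k)"
    unfolding openin_grassmannian_topology by simp
  have "topspace (grassmannian_topology smul k) \<subseteq> grassmannian smul k"
    using openin_topspace[of "grassmannian_topology smul k"]
    unfolding openin_grassmannian_topology by (rule conjunct1)
  then show ?thesis
    using openin_subset[OF gr] by (intro subset_antisym)
qed


section \<open>Model determinantal singularities and their transforms\<close>

definition det_sing :: "nat \<Rightarrow> (complex^'n^'m) set" where
  "det_sing t = {A. rank A < t}"

definition det_sing_dim :: "'n itself \<Rightarrow> 'm itself \<Rightarrow> nat \<Rightarrow> nat" where
  "det_sing_dim _ _ t =
     CARD('m) * CARD('n) - (CARD('m) - t + 1) * (CARD('n) - t + 1)"

text \<open>
  Velocities at \<open>A\<close> of holomorphic curve germs in \<open>X\<close> through \<open>A\<close>. At a point where \<open>X\<close> is a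
  complex submanifold this is its holomorphic tangent space; it is only used at such points.
\<close>

definition tangent_space :: "(complex^'n^'m) set \<Rightarrow> complex^'n^'m \<Rightarrow> (complex^'n^'m) set" where
  "tangent_space X A =
     {B. \<exists>\<gamma> e. e > 0 \<and> \<gamma> 0 = A \<and> (\<forall>z\<in>ball 0 e. \<gamma> z \<in> X) \<and>
        (\<forall>i j. (\<lambda>z. \<gamma> z $ i $ j) holomorphic_on ball 0 e \<and>
               ((\<lambda>z. \<gamma> z $ i $ j) has_field_derivative B $ i $ j) (at 0))}"

definition Tjur :: "nat \<Rightarrow> ((complex^'n^'m) \<times> (complex^'n) set) set" where
  "Tjur t = {(A, W). W \<in> grassmannian (*s) (CARD('n) - t + 1) \<and> (\<forall>w\<in>W. A *v w = 0)}"

definition TjurT :: "nat \<Rightarrow> ((complex^'n^'m) \<times> (complex^'m) set) set" where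
  "TjurT t = {(A, W). W \<in> grassmannian (*s) (CARD('m) - t + 1) \<and> (\<forall>w\<in>W. transpose A *v w = 0)}"

text \<open>The ambient spaces \<open>M \<times> Gr\<close> of the three transforms.\<close>

definition Tjur_ambient :: "nat \<Rightarrow> ((complex^'n^'m) \<times> (complex^'n) set) topology" where
  "Tjur_ambient t =
     prod_topology euclidean (grassmannian_topology (*s) (CARD('n) - t + 1))"

definition TjurT_ambient :: "nat \<Rightarrow> ((complex^'n^'m) \<times> (complex^'m) set) topology" where
  "TjurT_ambient t =
     prod_topology euclidean (grassmannian_topology (*s) (CARD('m) - t + 1))"

definition Nash_ambient :: "nat \<Rightarrow> ((complex^'n^'m) \<times> (complex^'n^'m) set) topology" where
  "Nash_ambient t =
     prod_topology euclidean
       (grassmannian_topology mscale (det_sing_dim TYPE('n) TYPE('m) t))"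

definition Nash :: "nat \<Rightarrow> ((complex^'n^'m) \<times> (complex^'n^'m) set) set" where
  "Nash t = Nash_ambient t closure_of
     {(A, tangent_space (det_sing t) A) | A. A \<in> det_sing t - det_sing (t - 1)}"

end

theory Submission
  imports Defs
begin

text \<open>
  All three transforms are subsets of \<open>M \<times> Gr\<close> that are stable under the maps
  \<open>(A, W) \<mapsto> (s A, W)\<close> with \<open>0 \<le> s \<le> 1\<close>. These maps shrink the matrix to zero while keeping the
  subspace, so they deform the transform onto its fibre over the zero matrix. They are
  continuous whatever the topology on the second factor, because that factor does not move.

  For the two Tjurina transforms stability is immediate from linearity. For the Nash transform the
  determinantal singularity is a cone, so for \<open>s > 0\<close> a point and its multiple by \<open>s\<close> have the
  same rank and the same tangent space; the graph of the Gauss map is therefore stable under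
  \<open>s > 0\<close>, and by continuity so is its closure. The value \<open>s = 0\<close> leaves the graph, but it is
  recovered in the closure, since \<open>(0, W)\<close> is the limit of \<open>(s A, W)\<close> as \<open>s\<close> tends to zero.
\<close>

lemma continuous_map_scaleR:
  fixes f :: "'c \<Rightarrow> real" and g :: "'c \<Rightarrow> 'a::real_normed_vector"
  assumes "continuous_map X euclidean f" "continuous_map X euclidean g"
  shows "continuous_map X euclidean (\<lambda>x. f x *\<^sub>R g x)"
proof -
  have "continuous_map X euclidean (\<lambda>x. (f x, g x))"
    using continuous_map_pairedI[OF assms] by simp
  moreover have "continuous_map euclidean euclidean (\<lambda>p. fst p *\<^sub>R snd p :: 'a)"
    by (auto intro!: continuous_intros)
  ultimately have "continuous_map X euclidean ((\<lambda>p. fst p *\<^sub>R snd p) \<circ> (\<lambda>x. (f x, g x)))"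
    by (rule continuous_map_compose)
  then show ?thesis by (simp add: o_def)
qed

text \<open>
  The straight-line homotopy in the first factor deforms \<open>X\<close> onto its zero fibre; stability at \<open>s = 0\<close> is what makes the retraction \<open>(A, W) \<mapsto> (0, W)\<close> land in \<open>X\<close>.
\<close>

lemma scaling_invariant_homotopy_equivalent_zero_fibre:
  fixes X :: "('a::real_normed_vector \<times> 'b) set"
  assumes scale: "\<And>s A W. \<lbrakk>0 \<le> s; s \<le> 1; (A, W) \<in> X\<rbrakk> \<Longrightarrow> (s *\<^sub>R A, W) \<in> X"
  shows "subtopology (prod_topology euclidean G) X homotopy_equivalent_space
         subtopology (prod_topology euclidean G) {p \<in> X. fst p = 0}"
proof -
  let ?Y = "prod_topology (euclidean :: 'a topology) G"
  let ?X = "subtopology ?Y X"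
  let ?r = "\<lambda>p. (0, snd p) :: 'a \<times> 'b"
  have r: "?r p \<in> X" if "p \<in> X" for p
    using scale[of 0 "fst p" "snd p"] that by simp
  have cont_h: "continuous_map (prod_topology (top_of_set {0..1}) ?X) ?X
      (\<lambda>(s, p). (s *\<^sub>R fst p, snd p))" (is "continuous_map ?P _ ?h")
  proof -
    have s: "continuous_map ?P euclideanreal fst"
      using continuous_map_fst[of "top_of_set {0..1::real}" ?X]
      by (simp add: continuous_map_in_subtopology)
    have snd: "continuous_map ?P ?Y snd"
      using continuous_map_snd[of "top_of_set {0..1::real}" ?X]
      by (simp add: continuous_map_in_subtopology)
    have A: "continuous_map ?P euclidean (fst \<circ> snd)"
      using snd continuous_map_fst by (rule continuous_map_compose)
    have W: "continuous_map ?P G (snd \<circ> snd)"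
      using snd continuous_map_snd by (rule continuous_map_compose)
    have sA: "continuous_map ?P euclidean (\<lambda>q. fst q *\<^sub>R (fst \<circ> snd) q)"
      using s A by (rule continuous_map_scaleR)
    have "continuous_map ?P ?Y ?h"
      using sA W by (simp add: continuous_map_pairwise o_def case_prod_unfold)
    moreover have "?h ` topspace ?P \<subseteq> X"
      using scale by auto
    ultimately show ?thesis
      by (simp add: continuous_map_in_subtopology image_subset_iff_funcset)
  qed
  have "homotopic_with (\<lambda>_. True) ?X ?X ?r id"
    unfolding homotopic_with_def using cont_h
    by (intro exI[of _ "\<lambda>(s, p). (s *\<^sub>R fst p, snd p)"]) auto
  moreover have "retraction_maps ?X (subtopology ?Y {p \<in> X. fst p = 0}) ?r id"
    unfolding retraction_maps_def
  proof (intro conjI)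
    have "continuous_map ?X ?Y ?r"
      by (auto simp: continuous_map_pairwise o_def
          intro!: continuous_map_from_subtopology continuous_map_snd)
    then show "continuous_map ?X (subtopology ?Y {p \<in> X. fst p = 0}) ?r"
      using r by (auto simp: continuous_map_in_subtopology)
    show "continuous_map (subtopology ?Y {p \<in> X. fst p = 0}) ?X id"
      by (auto simp: continuous_map_in_subtopology)
  qed auto
  ultimately show ?thesis
    by (rule deformation_retract_imp_homotopy_equivalent_space)
qed

lemma rank_scaleR_le:
  fixes A :: "complex^'n^'m"
  shows "rank (s *\<^sub>R A) \<le> rank A"
proof -
  have "row i (s *\<^sub>R A) = complex_of_real s *s row i A" for i
    by (simp add: row_def vec_eq_iff) (simp add: scaleR_conv_of_real)
  then have "rows (s *\<^sub>R A) \<subseteq> vec.span (rows A)"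
    by (auto simp: rows_def intro!: vec.span_scale intro: vec.span_base)
  then show ?thesis
    unfolding row_rank_def_gen by (rule vec.dim_mono)
qed

lemma rank_scaleR:
  fixes A :: "complex^'n^'m"
  assumes "s \<noteq> 0"
  shows "rank (s *\<^sub>R A) = rank A"
  using rank_scaleR_le[of s A] rank_scaleR_le[of "inverse s" "s *\<^sub>R A"] assms by simp

lemma scaleR_in_det_sing_iff:
  fixes A :: "complex^'n^'m"
  assumes "s \<noteq> 0"
  shows "s *\<^sub>R A \<in> det_sing t \<longleftrightarrow> A \<in> det_sing t"
  using assms by (simp add: det_sing_def rank_scaleR)

text \<open>
  If \<open>\<gamma>\<close> is a curve germ through \<open>A\<close>, then \<open>z \<mapsto> s \<gamma>(z / s)\<close> is a curve germ through \<open>s A\<close>. The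
  reparametrisation cancels the factor \<open>s\<close>, so both germs have the same velocity.
\<close>

lemma tangent_space_subset_scaleR:
  assumes s: "0 < s" and cone: "\<And>A. A \<in> X \<Longrightarrow> s *\<^sub>R A \<in> X"
  shows "tangent_space X A \<subseteq> tangent_space X (s *\<^sub>R A)"
proof
  fix B assume "B \<in> tangent_space X A"
  then obtain \<gamma> e where e: "e > 0" and \<gamma>0: "\<gamma> 0 = A" and \<gamma>X: "\<And>z. z \<in> ball 0 e \<Longrightarrow> \<gamma> z \<in> X"
    and hol: "\<And>i j. (\<lambda>z. \<gamma> z $ i $ j) holomorphic_on ball 0 e"
    and der: "\<And>i j. ((\<lambda>z. \<gamma> z $ i $ j) has_field_derivative B $ i $ j) (at 0)"
    unfolding tangent_space_def by blast
  define \<delta> where "\<delta> = (\<lambda>z. s *\<^sub>R \<gamma> (z / of_real s))"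
  have in_ball: "z / of_real s \<in> ball 0 e" if "z \<in> ball 0 (s * e)" for z :: complex
    using that s by (simp add: norm_divide divide_less_eq mult.commute)
  have "\<delta> 0 = s *\<^sub>R A" by (simp add: \<delta>_def \<gamma>0)
  moreover have "\<delta> z \<in> X" if "z \<in> ball 0 (s * e)" for z
    unfolding \<delta>_def using cone \<gamma>X in_ball[OF that] by blast
  moreover have "(\<lambda>z. \<delta> z $ i $ j) holomorphic_on ball 0 (s * e)" for i j
  proof -
    have "(\<lambda>z. \<gamma> z $ i $ j) \<circ> (\<lambda>z. z / of_real s) holomorphic_on ball 0 (s * e)"
      using s in_ball by (intro holomorphic_on_compose_gen[OF _ hol] holomorphic_intros) auto
    then show ?thesis
      unfolding \<delta>_def by (simp add: o_def) (auto simp: scaleR_conv_of_real intro!: holomorphic_intros)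
  qed
  moreover have "((\<lambda>z. \<delta> z $ i $ j) has_field_derivative B $ i $ j) (at 0)" for i j
  proof -
    have "((\<lambda>z. z / of_real s) has_field_derivative 1 / of_real s) (at (0::complex))"
      using s by (auto intro!: derivative_eq_intros)
    then have "((\<lambda>z. \<gamma> (z / of_real s) $ i $ j) has_field_derivative B $ i $ j * (1 / of_real s)) (at 0)"
      using der[of i j] by (intro DERIV_chain2[where f = "\<lambda>z. \<gamma> z $ i $ j"]) auto
    from DERIV_cmult[OF this, of "of_real s"] show ?thesis
      using s by (simp add: \<delta>_def) (simp add: scaleR_conv_of_real)
  qed
  ultimately show "B \<in> tangent_space X (s *\<^sub>R A)"
    unfolding tangent_space_def using s e by (auto intro!: exI[of _ \<delta>] exI[of _ "s * e"])
qed

lemma tangent_space_det_sing_scaleR: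
  assumes "0 < s"
  shows "tangent_space (det_sing t) (s *\<^sub>R A) = tangent_space (det_sing t) A"
proof (rule subset_antisym)
  show "tangent_space (det_sing t) A \<subseteq> tangent_space (det_sing t) (s *\<^sub>R A)"
    using assms by (intro tangent_space_subset_scaleR) (simp_all add: scaleR_in_det_sing_iff)
  have "tangent_space (det_sing t) (s *\<^sub>R A) \<subseteq> tangent_space (det_sing t) (inverse s *\<^sub>R s *\<^sub>R A)"
    using assms by (intro tangent_space_subset_scaleR) (simp_all add: scaleR_in_det_sing_iff)
  then show "tangent_space (det_sing t) (s *\<^sub>R A) \<subseteq> tangent_space (det_sing t) A"
    using assms by simp
qed

text \<open>
  Each scaling with \<open>0 < s \<le> 1\<close> is a continuous self-map of the ambient space, so it preserves the
  closure along with \<open>S\<close>.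
  The ray \<open>s \<mapsto> (s A, W)\<close> then runs inside the closed set for \<open>0 < s \<le> 1\<close>, hence also at its
  endpoint \<open>s = 0\<close>.
\<close>

lemma closure_of_scaling_invariant:
  fixes S :: "('a::real_normed_vector \<times> 'b) set"
  assumes scale: "\<And>s A W. \<lbrakk>0 < s; s \<le> 1; (A, W) \<in> S\<rbrakk> \<Longrightarrow> (s *\<^sub>R A, W) \<in> S"
    and s: "0 \<le> s" "s \<le> 1"
    and AW: "(A, W) \<in> prod_topology euclidean G closure_of S"
  shows "(s *\<^sub>R A, W) \<in> prod_topology euclidean G closure_of S"
proof -
  let ?Y = "prod_topology (euclidean :: 'a topology) G"
  have W: "W \<in> topspace G"
    using AW closure_of_subset_topspace[of ?Y S] by auto
  have pos: "(s *\<^sub>R A, W) \<in> ?Y closure_of S" if "0 < s" "s \<le> 1" for s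
  proof -
    let ?f = "\<lambda>p. (s *\<^sub>R fst p, snd p) :: 'a \<times> 'b"
    have "continuous_map ?Y euclidean (\<lambda>p. s *\<^sub>R fst p)"
      by (rule continuous_map_scaleR[OF _ continuous_map_fst]) simp
    then have "continuous_map ?Y ?Y ?f"
      by (simp add: continuous_map_pairwise o_def continuous_map_snd)
    then have "?f ` (?Y closure_of S) \<subseteq> ?Y closure_of (?f ` S)"
      by (rule continuous_map_image_closure_subset)
    also have "\<dots> \<subseteq> ?Y closure_of S"
      using scale that by (intro closure_of_mono) auto
    finally show ?thesis using AW by force
  qed
  let ?ray = "\<lambda>s. (s *\<^sub>R A, W)"
  have "continuous_map euclideanreal ?Y ?ray"
    using W by (auto simp: continuous_map_pairwise o_def intro!: continuous_intros)
  then have "?ray ` (euclideanreal closure_of {0<..1}) \<subseteq> ?Y closure_of (?ray ` {0<..1})"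
    by (rule continuous_map_image_closure_subset)
  also have "\<dots> \<subseteq> ?Y closure_of S"
    using pos by (intro closure_of_minimal) auto
  finally have "?ray ` {0..1} \<subseteq> ?Y closure_of S" by simp
  moreover have "s \<in> {0..1}" using s by simp
  ultimately show ?thesis by blast
qed

lemma Nash_scaling_invariant:
  assumes "0 \<le> s" "s \<le> 1" "(A, W) \<in> Nash t"
  shows "(s *\<^sub>R A, W) \<in> Nash t"
  using assms unfolding Nash_def Nash_ambient_def
  by (elim closure_of_scaling_invariant[rotated -1])
    (auto simp: scaleR_in_det_sing_iff tangent_space_det_sing_scaleR)

lemma scaleR_matrix_vector_mult_eq_0:
  fixes A :: "complex^'n^'m"
  assumes "A *v w = 0"
  shows "(s *\<^sub>R A) *v w = 0"
  using assms
  by (simp add: matrix_vector_mult_def vec_eq_iff scaleR_sum_right[symmetric])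

theorem proposition3p4:
  fixes t :: nat
  assumes "1 \<le> t" and "t \<le> min CARD('m::finite) CARD('n::finite)"
  shows
    "subtopology (Tjur_ambient t) (Tjur t :: ((complex^'n^'m) \<times> (complex^'n) set) set)
           homotopy_equivalent_space
         subtopology (Tjur_ambient t) {p \<in> Tjur t. fst p = (0 :: complex^'n^'m)} \<and>
     subtopology (TjurT_ambient t) (TjurT t :: ((complex^'n^'m) \<times> (complex^'m) set) set)
           homotopy_equivalent_space
         subtopology (TjurT_ambient t) {p \<in> TjurT t. fst p = (0 :: complex^'n^'m)} \<and>
     subtopology (Nash_ambient t) (Nash t :: ((complex^'n^'m) \<times> (complex^'n^'m) set) set)
           homotopy_equivalent_space
         subtopology (Nash_ambient t) {p \<in> Nash t. fst p = (0 :: complex^'n^'m)}"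
  unfolding Tjur_ambient_def TjurT_ambient_def Nash_ambient_def
proof (intro conjI; rule scaling_invariant_homotopy_equivalent_zero_fibre)
qed (auto simp: Tjur_def TjurT_def transpose_scalar simp del: transpose_matrix_vector
    intro: scaleR_matrix_vector_mult_eq_0 Nash_scaling_invariant)

end
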